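(* Let $m,n,p$ be integers with $m\geq 2$, $n\geq 2$ and $\lfloor \frac{n}{2}\rfloor\geq p\geq 0$. Then $$\left\lfloor\frac{n}{2}\right\rfloor+p+1\leq \min\left\{\chi(m,n,p),\ \chi^w(m,n,p)\right\},$$ where $\chi(m,n,p)$ (resp. $\chi^w(m,n,p)$) is the maximum of the numbers of connected components of the Pareto solution sets (resp. weak Pareto solution sets) of monotone affine vector variational inequalities with $m$ criteria, $n$ variables and $p$ linear constraints.
   Context: An affine vector variational inequality with $n$ variables, $m$ criteria and $p$ linear constraints is given by a nonempty polyhedral convex set $K=\{x\in\mathbb{R}^n: Ax\geq b\}$ with $A\in\mathbb{R}^{p\times n}$, $b\in\mathbb{R}^p$ (inequality componentwise; $K=\mathbb{R}^n$ if $p=0$), and affine operators $F_i(x)=M_ix+q_i$, $i=1,\dots,m$, with $M_i\in\mathbb{R}^{n\times n}$, $q_i\in\mathbb{R}^n$. It is monotone if every $F_i$ is monotone on $K$, i.e. $\langle F_i(y)-F_i(x),y-x\rangle\geq 0$ for all $x,y\in K$. For $x\in K$, $u\in\mathbb{R}^n$ put $F(x)(u)=(\langle F_1(x),u\rangle,\dots,\langle F_m(x),u\rangle)\in\mathbb{R}^m$, and let $C=\mathbb{R}^m_+$ be the nonnegative orthant. The Pareto solution set is the set of $x\in K$ such that $F(x)(x-y)\notin C\setminus\{0\}$ for all $y\in K$. The weak Pareto solution set is the set of $x\in K$ such that $F(x)(x-y)\notin \mathrm{int}\,C$ for all $y\in K$. The maxima defining $\chi(m,n,p)$ and $\chi^w(m,n,p)$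 are taken over all monotone affine vector variational inequalities with the given $m,n,p$; it is known that they are finite, being at most $2\times 3^{2m+2n+3p+1}$. *)

theory Defs
  imports "HOL-Analysis.Analysis" "HOL-Library.Extended_Nat"
begin

text \<open>
  The numbers of variables and criteria are \<^term>\<open>CARD('n)\<close> and \<^term>\<open>CARD('m)\<close>. The number
  \<open>p\<close> of constraints may be zero, so the rows of \<open>A\<close> and the entries of \<open>b\<close> are indexed by the
  natural numbers below \<open>p\<close> rather than by a (necessarily nonempty) type.
\<close>

definition constraint_set :: "nat \<Rightarrow> (nat \<Rightarrow> real ^ 'n) \<Rightarrow> (nat \<Rightarrow> real) \<Rightarrow> (real ^ 'n) set" where
  "constraint_set p A b = {x. \<forall>j<p. A j \<bullet> x \<ge> b j}"

definition monotone_operator_on :: "(real ^ 'n) set \<Rightarrow> (real ^ 'n \<Rightarrow> real ^ 'n) \<Rightarrow> bool" where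
  "monotone_operator_on K G \<longleftrightarrow> (\<forall>x\<in>K. \<forall>y\<in>K. (G y - G x) \<bullet> (y - x) \<ge> 0)"

definition monotone_avvi ::
    "nat \<Rightarrow> (real ^ 'n) set \<Rightarrow> ('m::finite \<Rightarrow> real ^ 'n \<Rightarrow> real ^ 'n) \<Rightarrow> bool" where
  "monotone_avvi p K F \<longleftrightarrow>
     (\<exists>A b. K = constraint_set p A b) \<and> K \<noteq> {} \<and>
     (\<exists>(M :: 'm \<Rightarrow> real ^ 'n ^ 'n) q. \<forall>i x. F i x = M i *v x + q i) \<and>
     (\<forall>i. monotone_operator_on K (F i))"

definition vector_value ::
    "('m::finite \<Rightarrow> real ^ 'n \<Rightarrow> real ^ 'n) \<Rightarrow> real ^ 'n \<Rightarrow> real ^ 'n \<Rightarrow> real ^ 'm" where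
  "vector_value F x u = (\<chi> i. F i x \<bullet> u)"

definition nonneg_orthant :: "(real ^ 'm) set" where
  "nonneg_orthant = {z. \<forall>i. z $ i \<ge> 0}"

definition pareto_solutions ::
    "(real ^ 'n) set \<Rightarrow> ('m::finite \<Rightarrow> real ^ 'n \<Rightarrow> real ^ 'n) \<Rightarrow> (real ^ 'n) set" where
  "pareto_solutions K F =
     {x \<in> K. \<forall>y\<in>K. vector_value F x (x - y) \<notin> nonneg_orthant - {0}}"

definition weak_pareto_solutions ::
    "(real ^ 'n) set \<Rightarrow> ('m::finite \<Rightarrow> real ^ 'n \<Rightarrow> real ^ 'n) \<Rightarrow> (real ^ 'n) set" where
  "weak_pareto_solutions K F =
     {x \<in> K. \<forall>y\<in>K. vector_value F x (x - y) \<notin> interior nonneg_orthant}"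

definition num_components :: "'a::topological_space set \<Rightarrow> enat" where
  "num_components S = (if finite (components S) then enat (card (components S)) else \<infinity>)"

text \<open>
  The two maxima are taken in \<^typ>\<open>enat\<close>, where \<^const>\<open>Sup\<close> of a nonempty finite set is its
  maximum. The component counts are known to be bounded by \<open>2 * 3 ^ (2 * m + 2 * n + 3 * p + 1)\<close>,
  so these suprema are attained; the definitions do not depend on that result.
\<close>

definition max_pareto_components :: "'m::finite itself \<Rightarrow> 'n::finite itself \<Rightarrow> nat \<Rightarrow> enat" where
  "max_pareto_components TYPE('m) TYPE('n) p =
     Sup {num_components (pareto_solutions K F) |
            K (F :: 'm \<Rightarrow> real ^ 'n \<Rightarrow> real ^ 'n). monotone_avvi p K F}"

definition max_weak_pareto_components :: "'m::finite itself \<Rightarrow> 'n::finite itself \<Rightarrow> nat \<Rightarrow> enat" where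
  "max_weak_pareto_components TYPE('m) TYPE('n) p =
     Sup {num_components (weak_pareto_solutions K F) |
            K (F :: 'm \<Rightarrow> real ^ 'n \<Rightarrow> real ^ 'n). monotone_avvi p K F}"

end

theory Submission
  imports Defs
begin

text \<open>
  Split \<open>2h\<close> of the \<open>n\<close> coordinates, \<open>h = n div 2\<close>, into pairs \<open>(a k, b k)\<close> and consider the
  one-parameter family of operators which on the \<open>k\<close>-th pair is
  \<open>(x\<^sub>a, x\<^sub>b) \<mapsto> (s * x\<^sub>b + 1, s * (1 - x\<^sub>a))\<close> with \<open>s = t - (2k+1)\<close>. Its linear part is skew, hence
  it is monotone, and it is affine in \<open>t\<close>. Two far apart parameters give the criteria, and
  scalarisation turns weak Pareto solutions into solutions of the variational inequality at some
  \<open>t\<close>. Under the constraints \<open>x\<^sub>a \<ge> 0\<close> for the first \<open>p\<close> pairs, such a solution has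
  \<open>x\<^sub>a = 1\<close> and \<open>x\<^sub>b = -1/s\<close> if \<open>s \<noteq> 0\<close>, while for \<open>s = 0\<close> there is no solution on an unconstrained
  pair and exactly the line \<open>x\<^sub>a = 0\<close> on a constrained one. So each of the \<open>h\<close> values \<open>t = 2k+1\<close>
  separates the solution set, and the first \<open>p\<close> of them contribute a component of their own.
\<close>

section \<open>Component counts, the orthant and scalarisation\<close>

text \<open>By \<open>sep\<close>, mapping \<open>i\<close> to the component of \<open>g i\<close>
  is injective. With infinitely many components the count is infinite and the bound is
  trivial.\<close>

lemma card_le_num_components:
  assumes "finite I" "g ` I \<subseteq> S"
    and sep: "\<And>C i j. \<lbrakk>connected C; C \<subseteq> S; i \<in> I; j \<in> I; g i \<in> C; g j \<in> C\<rbrakk> \<Longrightarrow> i = j"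
  shows "enat (card I) \<le> num_components S"
proof (cases "finite (components S)")
  case True
  define c where "c i = connected_component_set S (g i)" for i
  have "inj_on c I"
  proof (rule inj_onI)
    fix i j assume ij: "i \<in> I" "j \<in> I" "c i = c j"
    have "g i \<in> c i" "g j \<in> c j"
      using assms(2) ij(1,2) unfolding c_def by (auto simp: connected_component_refl_eq)
    moreover have "connected (c i)" "c i \<subseteq> S"
      by (simp_all add: c_def connected_component_subset)
    ultimately show "i = j"
      using ij sep[of "c i" i j] by metis
  qed
  moreover have "c ` I \<subseteq> components S"
    using assms(2) by (auto simp: c_def components_def)
  ultimately have "card I \<le> card (components S)"
    using True by (intro card_inj_on_le)
  then show ?thesis using True by (simp add: num_components_def)
qed (simp add: num_components_def)

lemma pos_in_interior_nonneg_orthant: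
  fixes z :: "real ^ 'm"
  assumes "\<And>i. z $ i > 0"
  shows "z \<in> interior nonneg_orthant"
proof (rule interiorI)
  have "{z :: real ^ 'm. \<forall>i. 0 < z $ i} = (\<Inter>i. {z. 0 < z $ i})" by auto
  then show "open {z :: real ^ 'm. \<forall>i. 0 < z $ i}"
    by (simp add: open_INT open_halfspace_component_gt_cart)
qed (use assms in \<open>auto simp: nonneg_orthant_def less_imp_le\<close>)

lemma pareto_subset_weak_pareto:
  "pareto_solutions K (F :: 'm::finite \<Rightarrow> real ^ 'n \<Rightarrow> real ^ 'n) \<subseteq> weak_pareto_solutions K F"
proof -
  have "(0 :: real ^ 'm) \<notin> interior nonneg_orthant"
  proof
    assume "(0 :: real ^ 'm) \<in> interior nonneg_orthant"
    then obtain e where e: "e > 0" "ball (0 :: real ^ 'm) e \<subseteq> nonneg_orthant"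
      by (auto simp: mem_interior)
    define z :: "real ^ 'm" where "z = (- (e / 2)) *\<^sub>R axis undefined 1"
    have "z \<in> ball 0 e" using e by (simp add: z_def norm_axis_1)
    moreover have "z \<notin> nonneg_orthant"
      using e by (auto simp: z_def nonneg_orthant_def axis_def intro!: exI[of _ undefined])
    ultimately show False using e by auto
  qed
  then have "interior nonneg_orthant \<subseteq> nonneg_orthant - {0 :: real ^ 'm}"
    using interior_subset by blast
  then show ?thesis by (auto simp: pareto_solutions_def weak_pareto_solutions_def)
qed

text \<open>The image of \<open>x - K\<close> under both functionals misses the open positive
  quadrant. A separating line has a normal with nonnegative entries and can only have offset 0, so
  the normal supplies the weights.\<close>

lemma two_criteria_scalarization:
  fixes v w x :: "'a :: euclidean_space"
  assumes "convex K" "x \<in> K"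
    and no: "\<And>y. y \<in> K \<Longrightarrow> \<not> (v \<bullet> (x - y) > 0 \<and> w \<bullet> (x - y) > 0)"
  shows "\<exists>\<alpha> \<beta>. \<alpha> \<ge> 0 \<and> \<beta> \<ge> 0 \<and> \<alpha> + \<beta> > (0::real) \<and>
           (\<forall>y\<in>K. \<alpha> * (v \<bullet> (y - x)) + \<beta> * (w \<bullet> (y - x)) \<ge> 0)"
proof -
  define S where "S = (\<lambda>d. (v \<bullet> d, w \<bullet> d)) ` ((\<lambda>y. x - y) ` K)"
  define T where "T = ({0<..} :: real set) \<times> ({0<..} :: real set)"
  have "linear (\<lambda>d. (v \<bullet> d, w \<bullet> d))"
    by (intro linearI) (auto simp: inner_simps)
  moreover have "(\<lambda>y. x - y) ` K = (\<lambda>y. x + y) ` (uminus ` K)"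
    by (simp add: image_image)
  ultimately have "convex S"
    unfolding S_def using \<open>convex K\<close>
    by (simp add: convex_linear_image convex_translation convex_negations)
  moreover have "convex T" unfolding T_def by (intro convex_Times) auto
  moreover have "S \<noteq> {}" "T \<noteq> {}" "S \<inter> T = {}"
    using assms(2) no by (auto simp: S_def T_def)
  ultimately obtain n c where n: "n \<noteq> 0" "\<And>z. z \<in> S \<Longrightarrow> n \<bullet> z \<le> c" "\<And>z. z \<in> T \<Longrightarrow> c \<le> n \<bullet> z"
    using separating_hyperplane_sets[of S T] by blast
  obtain \<alpha> \<beta> where ab: "n = (\<alpha>, \<beta>)" by (cases n)
  have up: "\<alpha> * (v \<bullet> (x - y)) + \<beta> * (w \<bullet> (x - y)) \<le> c" if "y \<in> K" for y
    using n(2)[of "(v \<bullet> (x - y), w \<bullet> (x - y))"] that by (auto simp: S_def ab)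
  have lo: "c \<le> \<alpha> * r + \<beta> * s" if "r > 0" "s > 0" for r s
    using n(3)[of "(r, s)"] that by (auto simp: T_def ab)
  have "c \<ge> 0" using up[OF assms(2)] by simp
  have "\<alpha> \<ge> 0"
  proof (rule ccontr)
    assume "\<not> \<alpha> \<ge> 0"
    \<comment> \<open>At this first coordinate and second coordinate 1 the normal takes the value
      \<beta> - |\<beta>| - 1 < 0 \<le> c.\<close>
    then have "0 < (\<bar>\<beta>\<bar> + 1) / - \<alpha>" by (intro divide_pos_pos) auto
    from lo[OF this, of 1] \<open>c \<ge> 0\<close> \<open>\<not> \<alpha> \<ge> 0\<close> show False by simp
  qed
  moreover have "\<beta> \<ge> 0"
  proof (rule ccontr)
    assume "\<not> \<beta> \<ge> 0"
    then have "0 < (\<bar>\<alpha>\<bar> + 1) / - \<beta>" by (intro divide_pos_pos) auto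
    from lo[OF _ this, of 1] \<open>c \<ge> 0\<close> \<open>\<not> \<beta> \<ge> 0\<close> show False by simp
  qed
  moreover have "\<alpha> + \<beta> > 0"
    using calculation n(1) ab by (auto simp: less_le add_nonneg_eq_0_iff zero_prod_def)
  moreover have "c \<le> 0"
  proof (rule ccontr)
    assume "\<not> c \<le> 0"
    \<comment> \<open>This diagonal point of the quadrant is chosen to have value c / 2, below a
      positive c.\<close>
    then have "0 < c / (2 * (\<alpha> + \<beta>))" using \<open>\<alpha> + \<beta> > 0\<close> by simp
    from lo[OF this this] have "c \<le> (\<alpha> + \<beta>) * (c / (2 * (\<alpha> + \<beta>)))"
      by (simp only: distrib_right)
    also have "\<dots> = c / 2" using \<open>\<alpha> + \<beta> > 0\<close> by (simp add: field_simps)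
    finally show False using \<open>\<not> c \<le> 0\<close> by simp
  qed
  moreover have "\<alpha> * (v \<bullet> (y - x)) + \<beta> * (w \<bullet> (y - x)) \<ge> 0" if "y \<in> K" for y
    using up[OF that] \<open>c \<le> 0\<close> by (simp add: inner_diff_right algebra_simps)
  ultimately show ?thesis by blast
qed

lemma connected_coordinate_between:
  fixes C :: "(real ^ 'n) set"
  assumes "connected C" "x \<in> C" "y \<in> C" "x $ k \<le> c" "c \<le> y $ k"
  obtains z where "z \<in> C" "z $ k = c"
proof -
  have "connected ((\<lambda>z. z $ k) ` C)"
    using assms(1) by (intro connected_continuous_image continuous_intros)
  then have "c \<in> (\<lambda>z. z $ k) ` C"
    using assms connectedD_interval[of "(\<lambda>z. z $ k) ` C" "x $ k" "y $ k" c] by auto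
  then show thesis using that by auto
qed

section \<open>Skew operators on paired coordinates\<close>

locale paired_coordinates =
  fixes a b :: "nat \<Rightarrow> 'n::finite" and h p :: nat
  assumes inj_a: "inj_on a {..<h}" and inj_b: "inj_on b {..<h}"
    and a_neq_b: "\<And>k l. \<lbrakk>k < h; l < h\<rbrakk> \<Longrightarrow> a k \<noteq> b l"
    and p_le_h: "p \<le> h"
begin

lemma b_neq_a: "\<lbrakk>k < h; l < h\<rbrakk> \<Longrightarrow> b k \<noteq> a l"
  using a_neq_b[of l k] by simp

definition slope :: "real \<Rightarrow> nat \<Rightarrow> real" where
  "slope t k = t - (2 * real k + 1)"

definition G :: "real \<Rightarrow> real ^ 'n \<Rightarrow> real ^ 'n" where
  "G t x = (\<Sum>k<h. (slope t k * x $ b k + 1) *\<^sub>R axis (a k) 1 +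
                    (slope t k * (1 - x $ a k)) *\<^sub>R axis (b k) 1)"

definition K :: "(real ^ 'n) set" where
  "K = constraint_set p (\<lambda>k. axis (a k) 1) (\<lambda>_. 0)"

lemma mem_K_iff: "x \<in> K \<longleftrightarrow> (\<forall>k<p. x $ a k \<ge> 0)"
  by (simp add: K_def constraint_set_def inner_axis')

lemma G_inner:
  "G t x \<bullet> u = (\<Sum>k<h. (slope t k * x $ b k + 1) * u $ a k + slope t k * (1 - x $ a k) * u $ b k)"
  by (simp add: G_def inner_sum_left inner_add_left inner_axis')

text \<open>With \<open>d = y - x\<close> and \<open>s = slope t k\<close>, pair \<open>k\<close>
  contributes \<open>s * d_b * d_a\<close> and \<open>- s * d_a * d_b\<close>, which cancel.\<close>

lemma G_diff_orthogonal: "(G t y - G t x) \<bullet> (y - x) = 0"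
  by (simp add: inner_diff_left G_inner flip: sum_subtractf)
     (intro sum.neutral ballI, simp add: algebra_simps)

lemma linear_G_minus_G0: "linear (\<lambda>x. G t x - G t 0)"
proof -
  have *: "G t x - G t 0 =
      (\<Sum>k<h. (slope t k * x $ b k) *\<^sub>R axis (a k) 1 - (slope t k * x $ a k) *\<^sub>R axis (b k) 1)" for x
    by (simp add: G_def algebra_simps flip: sum_subtractf)
  show ?thesis
    unfolding * by (intro linearI) (simp_all add: algebra_simps scaleR_sum_right sum.distrib sum_subtractf)
qed

text \<open>The parameter enters only through the slopes, which are affine in it. A weighted sum of
  two operators is thus a multiple of the operator at the weighted mean parameter.\<close>

lemma G_affine:
  "(\<alpha> + \<beta>) * (G ((\<alpha> * s + \<beta> * t) / (\<alpha> + \<beta>)) x \<bullet> u) = \<alpha> * (G s x \<bullet> u) + \<beta> * (G t x \<bullet> u)"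
  if "\<alpha> + \<beta> \<noteq> 0"
proof -
  have "(\<alpha> + \<beta>) * ((\<alpha> * s + \<beta> * t) / (\<alpha> + \<beta>)) = \<alpha> * s + \<beta> * t"
    using that by simp
  then have slope_affine:
    "(\<alpha> + \<beta>) * slope ((\<alpha> * s + \<beta> * t) / (\<alpha> + \<beta>)) k = \<alpha> * slope s k + \<beta> * slope t k" for k
    unfolding slope_def by algebra
  have *: "(\<alpha> + \<beta>) * ((slope ((\<alpha> * s + \<beta> * t) / (\<alpha> + \<beta>)) k * c + 1) * d
                + slope ((\<alpha> * s + \<beta> * t) / (\<alpha> + \<beta>)) k * e * f)
     = \<alpha> * ((slope s k * c + 1) * d + slope s k * e * f) +
       \<beta> * ((slope t k * c + 1) * d + slope t k * e * f)" for c d e f k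
    using slope_affine[of k] by algebra
  show ?thesis unfolding G_inner sum_distrib_left * by (simp add: sum.distrib)
qed

lemma G_inner_axis_a: "k < h \<Longrightarrow> G t x \<bullet> axis (a k) c = (slope t k * x $ b k + 1) * c"
proof -
  assume k: "k < h"
  have "G t x \<bullet> axis (a k) c = (\<Sum>l<h. if l = k then (slope t k * x $ b k + 1) * c else 0)"
    unfolding G_inner using k
    by (intro sum.cong) (auto simp: axis_def a_neq_b b_neq_a inj_on_eq_iff[OF inj_a])
  then show ?thesis using k by simp
qed

lemma G_inner_axis_b: "k < h \<Longrightarrow> G t x \<bullet> axis (b k) c = slope t k * (1 - x $ a k) * c"
proof -
  assume k: "k < h"
  have "G t x \<bullet> axis (b k) c = (\<Sum>l<h. if l = k then slope t k * (1 - x $ a k) * c else 0)"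
    unfolding G_inner using k
    by (intro sum.cong) (auto simp: axis_def a_neq_b b_neq_a inj_on_eq_iff[OF inj_b])
  then show ?thesis using k by simp
qed

section \<open>Scalar variational inequalities\<close>

definition solves :: "real \<Rightarrow> real ^ 'n \<Rightarrow> bool" where
  "solves t x \<longleftrightarrow> x \<in> K \<and> (\<forall>y\<in>K. G t x \<bullet> (y - x) \<ge> 0)"

lemma solves_iff:
  "solves t x \<longleftrightarrow> (\<forall>k<h. if slope t k = 0 then k < p \<and> x $ a k = 0
                       else x $ a k = 1 \<and> slope t k * x $ b k = - 1)"
proof
  assume sol: "solves t x"
  then have x: "\<And>k. k < p \<Longrightarrow> x $ a k \<ge> 0"
    by (simp_all add: solves_def mem_K_iff)
  have vi: "G t x \<bullet> d \<ge> 0" if "x + d \<in> K" for d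
    using sol that unfolding solves_def by (metis add_diff_cancel_left')
  have "if slope t k = 0 then k < p \<and> x $ a k = 0
        else x $ a k = 1 \<and> slope t k * x $ b k = - 1" if k: "k < h" for k
  proof -
    have "x + axis (b k) c \<in> K" for c
      using x a_neq_b[of _ k] p_le_h k by (simp add: mem_K_iff axis_def)
    then have "slope t k * (1 - x $ a k) * c \<ge> 0" for c
      using vi[of "axis (b k) c"] by (simp add: G_inner_axis_b k)
    \<comment> \<open>The coordinate \<open>b k\<close> is unconstrained, so both directions are
      feasible.\<close>
    from this[of 1] this[of "-1"] have B: "slope t k * (1 - x $ a k) = 0" by simp
    have A: "(slope t k * x $ b k + 1) * c \<ge> 0" if "k < p \<Longrightarrow> x $ a k + c \<ge> 0" for c
    proof -
      have "x + axis (a k) c \<in> K"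
        using x that p_le_h k by (auto simp: mem_K_iff axis_def inj_on_eq_iff[OF inj_a])
      then show ?thesis using vi[of "axis (a k) c"] by (simp add: G_inner_axis_a k)
    qed
    show ?thesis
    proof (cases "slope t k = 0")
      case True
      then have A': "c \<ge> 0" if "k < p \<Longrightarrow> x $ a k + c \<ge> 0" for c
        using A[OF that] by simp
      \<comment> \<open>At slope 0 the operator has entry 1 at \<open>a k\<close>, so decreasing
        \<open>x $ a k\<close> must be infeasible: the pair is constrained and the coordinate sits
        on its bound.\<close>
      have "k < p" using A'[of "-1"] by auto
      moreover have "x $ a k \<le> 0" using A'[of "- x $ a k"] by simp
      ultimately show ?thesis using True x[of k] by simp
    next
      case False
      with B have "x $ a k = 1" by simp
      \<comment> \<open>From \<open>x $ a k = 1\<close> a step of -1 just reaches the bound 0, so it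
        is feasible even on a constrained pair.\<close>
      with A[of 1] A[of "-1"] False show ?thesis by simp
    qed
  qed
  then show "\<forall>k<h. if slope t k = 0 then k < p \<and> x $ a k = 0
                       else x $ a k = 1 \<and> slope t k * x $ b k = - 1" by blast
next
  assume R: "\<forall>k<h. if slope t k = 0 then k < p \<and> x $ a k = 0
                       else x $ a k = 1 \<and> slope t k * x $ b k = - 1"
  have "x $ a k \<ge> 0" if "k < h" for k
    using R that by (cases "slope t k = 0") auto
  then have "x \<in> K" using p_le_h by (simp add: mem_K_iff)
  moreover have "G t x \<bullet> (y - x) \<ge> 0" if "y \<in> K" for y
    unfolding G_inner
  proof (intro sum_nonneg)
    fix k assume "k \<in> {..<h}"
    then show "0 \<le> (slope t k * x $ b k + 1) * (y - x) $ a k + slope t k * (1 - x $ a k) * (y - x) $ b k"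
      \<comment> \<open>At slope 0 the summand reduces to \<open>y $ a k\<close> with
        \<open>k < p\<close>; otherwise both coefficients vanish.\<close>
      using R that by (cases "slope t k = 0") (auto simp: mem_K_iff)
  qed
  ultimately show "solves t x" by (simp add: solves_def)
qed

section \<open>Passage between the criteria and the scalar problems\<close>

text \<open>The two parameters enclose all slope zeros 1, 3, ..., 2h - 1. Every criterion other than
  \<open>i0\<close> is the same operator, so any number of criteria behaves like two.\<close>

definition F :: "'m::finite \<Rightarrow> 'm \<Rightarrow> real ^ 'n \<Rightarrow> real ^ 'n" where
  "F i0 i = G (if i = i0 then - 1 else 2 * real h + 1)"

lemma monotone_avvi_F: "monotone_avvi p K (F i0)"
proof -
  have "F i0 i x = matrix (\<lambda>x. F i0 i x - F i0 i 0) *v x + F i0 i 0" for i x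
    unfolding F_def by (subst matrix_works) (auto simp: linear_matrix_vector_mul_eq linear_G_minus_G0)
  then have "\<exists>M q. \<forall>i x. F i0 i x = M i *v x + q i"
    by (intro exI[of _ "\<lambda>i. matrix (\<lambda>x. F i0 i x - F i0 i 0)"] exI[of _ "\<lambda>i. F i0 i 0"]) blast
  moreover have "0 \<in> K" by (simp add: mem_K_iff)
  ultimately show ?thesis
    unfolding monotone_avvi_def
    by (auto simp: K_def monotone_operator_on_def F_def G_diff_orthogonal)
qed

text \<open>Strictly between the end parameters both weights are positive, so nonnegative criterion
  values with nonpositive weighted sum must all vanish.\<close>

lemma solves_imp_pareto:
  assumes "solves t x" "- 1 < t" "t < 2 * real h + 1" "i1 \<noteq> i0"
  shows "x \<in> pareto_solutions K (F i0)"
proof -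
  have "vector_value (F i0) x (x - y) = 0"
    if y: "y \<in> K" and nn: "vector_value (F i0) x (x - y) \<in> nonneg_orthant" for y
  proof -
    \<comment> \<open>Distances of t to the opposite ends: the weights making t the mean of -1 and
      2h + 1.\<close>
    define \<alpha> \<beta> where "\<alpha> = 2 * real h + 1 - t" and "\<beta> = t + 1"
    have pos: "\<alpha> > 0" "\<beta> > 0" using assms by (auto simp: \<alpha>_def \<beta>_def)
    have "(\<alpha> * (- 1) + \<beta> * (2 * real h + 1)) / (\<alpha> + \<beta>) = t"
      by (simp add: \<alpha>_def \<beta>_def divide_eq_eq) (simp add: algebra_simps)
    then have "\<alpha> * (G (- 1) x \<bullet> (x - y)) + \<beta> * (G (2 * real h + 1) x \<bullet> (x - y))
        = (\<alpha> + \<beta>) * (G t x \<bullet> (x - y))"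
      using G_affine[of \<alpha> \<beta> "- 1" "2 * real h + 1" x "x - y"] pos by simp
    moreover have "G t x \<bullet> (x - y) \<le> 0"
      using assms(1) y unfolding solves_def by (auto simp: inner_diff_right)
    moreover have nn2: "G (- 1) x \<bullet> (x - y) \<ge> 0" "G (2 * real h + 1) x \<bullet> (x - y) \<ge> 0"
      using nn \<open>i1 \<noteq> i0\<close> by (auto simp: nonneg_orthant_def vector_value_def F_def split: if_splits)
    ultimately have "\<alpha> * (G (- 1) x \<bullet> (x - y)) + \<beta> * (G (2 * real h + 1) x \<bullet> (x - y)) \<le> 0"
      using pos by (simp add: mult_nonneg_nonpos)
    moreover have "\<alpha> * (G (- 1) x \<bullet> (x - y)) \<ge> 0" "\<beta> * (G (2 * real h + 1) x \<bullet> (x - y)) \<ge> 0"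
      using pos nn2 by simp_all
    ultimately have "\<alpha> * (G (- 1) x \<bullet> (x - y)) = 0" "\<beta> * (G (2 * real h + 1) x \<bullet> (x - y)) = 0"
      by linarith+
    then show ?thesis using pos by (simp add: vector_value_def F_def vec_eq_iff)
  qed
  then show ?thesis using assms(1) by (auto simp: pareto_solutions_def solves_def)
qed

lemma weak_pareto_imp_solves:
  assumes "x \<in> weak_pareto_solutions K (F i0)"
  shows "\<exists>t. solves t x"
proof -
  let ?l = "- 1" and ?r = "2 * real h + 1"
  have xK: "x \<in> K" using assms by (simp add: weak_pareto_solutions_def)
  have "convex K"
    unfolding convex_def by (auto simp: mem_K_iff)
  moreover have "\<not> (G ?l x \<bullet> (x - y) > 0 \<and> G ?r x \<bullet> (x - y) > 0)" if "y \<in> K" for y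
  proof
    assume "G ?l x \<bullet> (x - y) > 0 \<and> G ?r x \<bullet> (x - y) > 0"
    then have "vector_value (F i0) x (x - y) \<in> interior nonneg_orthant"
      by (intro pos_in_interior_nonneg_orthant) (simp add: vector_value_def F_def)
    then show False using assms that by (simp add: weak_pareto_solutions_def)
  qed
  ultimately obtain \<alpha> \<beta> where ab: "\<alpha> + \<beta> > 0"
    "\<And>y. y \<in> K \<Longrightarrow> \<alpha> * (G ?l x \<bullet> (y - x)) + \<beta> * (G ?r x \<bullet> (y - x)) \<ge> 0"
    using two_criteria_scalarization[of K x "G ?l x" "G ?r x"] xK by blast
  have "G ((\<alpha> * ?l + \<beta> * ?r) / (\<alpha> + \<beta>)) x \<bullet> (y - x) \<ge> 0" if "y \<in> K" for y
    using G_affine[of \<alpha> \<beta> ?l ?r x "y - x"] ab(1) ab(2)[OF that]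
    by (metis less_irrefl zero_le_mult_iff not_less)
  then show ?thesis using xK unfolding solves_def by blast
qed

section \<open>Sample points and their separation\<close>

text \<open>Relies on \<open>x / 0 = 0\<close> when \<open>slope t k = 0\<close>; the coordinate \<open>b k\<close> is then arbitrary.\<close>

definition pt :: "real \<Rightarrow> real ^ 'n" where
  "pt t = (\<Sum>k<h. (if slope t k = 0 then 0 else 1) *\<^sub>R axis (a k) 1 + (- 1 / slope t k) *\<^sub>R axis (b k) 1)"

lemma pt_a: "k < h \<Longrightarrow> pt t $ a k = (if slope t k = 0 then 0 else 1)"
proof -
  assume k: "k < h"
  have "pt t $ a k = (\<Sum>l<h. if l = k then (if slope t k = 0 then 0 else 1) else 0)"
    unfolding pt_def sum_component using k
    by (intro sum.cong) (auto simp: axis_def a_neq_b b_neq_a inj_on_eq_iff[OF inj_a])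
  then show ?thesis using k by simp
qed

lemma pt_b: "k < h \<Longrightarrow> pt t $ b k = - 1 / slope t k"
proof -
  assume k: "k < h"
  have "pt t $ b k = (\<Sum>l<h. if l = k then - 1 / slope t k else 0)"
    unfolding pt_def sum_component using k
    by (intro sum.cong) (auto simp: axis_def a_neq_b b_neq_a inj_on_eq_iff[OF inj_b])
  then show ?thesis using k by simp
qed

text \<open>The even parameters sample the h + 1 intervals cut by the slope zeros; the odd ones are
  the zeros belonging to constrained pairs.\<close>

definition I :: "nat set" where
  "I = (\<lambda>j. 2 * j) ` {..h} \<union> (\<lambda>k. 2 * k + 1) ` {..<p}"

lemma finite_I: "finite I" by (simp add: I_def)

lemma card_I: "card I = h + p + 1"
proof -
  have "card I = card ((\<lambda>j::nat. 2 * j) ` {..h}) + card ((\<lambda>k::nat. 2 * k + 1) ` {..<p})"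
    unfolding I_def by (intro card_Un_disjoint) (auto, presburger)
  also have "\<dots> = h + p + 1"
    by (subst (1 2) card_image) (auto simp: inj_on_def)
  finally show ?thesis .
qed

lemma slope_eq_0_iff: "slope (real i) k = 0 \<longleftrightarrow> i = 2 * k + 1"
  unfolding slope_def by linarith

lemma pt_pareto:
  assumes "i \<in> I" "i1 \<noteq> i0"
  shows "pt (real i) \<in> pareto_solutions K (F i0)"
proof (rule solves_imp_pareto)
  show "solves (real i) (pt (real i))"
    unfolding solves_iff
  proof (intro allI impI)
    fix k assume k: "k < h"
    \<comment> \<open>An odd parameter in \<open>I\<close> makes a slope vanish only on a
      constrained pair; an even one makes none vanish.\<close>
    have "i = 2 * k + 1 \<Longrightarrow> k < p" using assms(1) by (auto simp: I_def) presburger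
    then show "if slope (real i) k = 0 then k < p \<and> pt (real i) $ a k = 0
               else pt (real i) $ a k = 1 \<and> slope (real i) k * pt (real i) $ b k = - 1"
      using k slope_eq_0_iff[of i k] by (cases "slope (real i) k = 0") (simp_all add: pt_a pt_b)
  qed
  have "i \<le> 2 * h" using assms(1) p_le_h by (auto simp: I_def)
  then show "real i < 2 * real h + 1" by linarith
qed (use assms in auto)

text \<open>Source of both obstructions to connectedness: \<open>x $ a k\<close> cannot move between
  0 and 1, and while it is 1, \<open>x $ b k\<close> cannot change sign.\<close>

lemma weak_pareto_coordinate_a:
  assumes "x \<in> weak_pareto_solutions K (F i0)" "k < h"
  shows "x $ a k = 0 \<or> (x $ a k = 1 \<and> x $ b k \<noteq> 0)"
proof -
  obtain t where "solves t x" using weak_pareto_imp_solves[OF assms(1)] by blast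
  then show ?thesis using assms(2) unfolding solves_iff by (cases "slope t k = 0") auto
qed

lemma coordinate_a_constant:
  assumes "connected C" "C \<subseteq> weak_pareto_solutions K (F i0)" "k < h" "x \<in> C" "y \<in> C"
    and "x $ a k = 0"
  shows "y $ a k = 0"
proof (rule ccontr)
  assume "y $ a k \<noteq> 0"
  then have "y $ a k = 1" using weak_pareto_coordinate_a[of y i0 k] assms by auto
  then obtain z where "z \<in> C" "z $ a k = 1/2"
    using connected_coordinate_between[OF assms(1), of x y "a k" "1/2"] assms by auto
  then show False using weak_pareto_coordinate_a[of z i0 k] assms by auto
qed

text \<open>Among the sample points, coordinate \<open>a k\<close> vanishes only at parameter 2k +
  1, which isolates odd parameters. Between two even ones some \<open>b k\<close> changes sign,
  forcing a point with \<open>a k\<close> equal to 0 in the same connected set.\<close>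

lemma pt_separated:
  assumes C: "connected C" "C \<subseteq> weak_pareto_solutions K (F i0)"
    and "i \<in> I" "j \<in> I" "pt (real i) \<in> C" "pt (real j) \<in> C"
  shows "i = j"
  using assms(3-6)
proof (induction i j rule: linorder_wlog)
  case (le i j)
  note const = coordinate_a_constant[OF C]
  show ?case
  proof (rule ccontr)
    assume "i \<noteq> j"
    with le have "i < j" by simp
    have even: "even l" if "l \<in> {i, j}" for l
    proof (rule ccontr)
      assume "odd l"
      with that le obtain k where k: "l = 2 * k + 1" "k < p" by (auto simp: I_def)
      then have "k < h" using p_le_h by simp
      with const[of k "pt (real i)" "pt (real j)"] const[of k "pt (real j)" "pt (real i)"] le k that
        \<open>i \<noteq> j\<close>
      show False by (auto simp: pt_a slope_eq_0_iff split: if_splits)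
    qed
    then obtain k where k: "i = 2 * k" by auto
    have "j \<le> 2 * h" using le p_le_h by (auto simp: I_def)
    with k \<open>i < j\<close> have kh: "k < h" by simp
    \<comment> \<open>Equal parity leaves room for the slope zero 2k + 1 strictly between i = 2k and
      j.\<close>
    have "i + 2 \<le> j" using \<open>i < j\<close> even[of i] even[of j] by (auto elim!: evenE)
    then have "slope (real i) k < 0" "slope (real j) k > 0"
      using k by (auto simp: slope_def)
    then have b: "pt (real j) $ b k \<le> 0" "0 \<le> pt (real i) $ b k" "pt (real i) $ a k = 1"
      using kh by (auto simp: pt_a pt_b divide_nonpos_pos divide_nonpos_neg)
    \<comment> \<open>The entry -1/s is positive before the zero of the slope and negative after it,
      so the later point is the lower end.\<close>
    then obtain z where z: "z \<in> C" "z $ b k = 0"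
      using connected_coordinate_between[OF C(1), of "pt (real j)" "pt (real i)" "b k" 0] le
      by auto
    then have "z $ a k = 0" using weak_pareto_coordinate_a[of z i0 k] C kh by auto
    then have "pt (real i) $ a k = 0" using const[OF kh z(1)] le by blast
    then show False using b by simp
  qed
next
  case (sym i j)
  then show ?case by blast
qed

text \<open>The points lie in the smaller Pareto set and are separated in the larger weak one, so
  the same family serves both counts.\<close>

lemma num_components_ge:
  assumes "(i1 :: 'm::finite) \<noteq> i0"
  shows "enat (h + p + 1) \<le> num_components (pareto_solutions K (F i0))"
    and "enat (h + p + 1) \<le> num_components (weak_pareto_solutions K (F i0))"
proof -
  note sub = pareto_subset_weak_pareto[of K "F i0"]
  show "enat (h + p + 1) \<le> num_components (pareto_solutions K (F i0))"
    unfolding card_I[symmetric]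
    by (rule card_le_num_components[OF finite_I, of "\<lambda>i. pt (real i)"])
       (use pt_pareto[OF _ assms] pt_separated[of _ i0] sub in \<open>blast+\<close>)
  show "enat (h + p + 1) \<le> num_components (weak_pareto_solutions K (F i0))"
    unfolding card_I[symmetric]
    by (rule card_le_num_components[OF finite_I, of "\<lambda>i. pt (real i)"])
       (use pt_pareto[OF _ assms] pt_separated[of _ i0] sub in \<open>blast+\<close>)
qed

end

section \<open>Choice of the pairs and the final bound\<close>

text \<open>Consecutive entries of an enumeration form the pairs; for odd n one coordinate stays
  unpaired.\<close>

lemma exists_paired_coordinates:
  assumes "p \<le> CARD('n) div 2"
  shows "\<exists>a b :: nat \<Rightarrow> 'n::finite. paired_coordinates a b (CARD('n) div 2) p"
proof -
  obtain e :: "nat \<Rightarrow> 'n" where "bij_betw e {0..<CARD('n)} UNIV"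
    using ex_bij_betw_nat_finite[of "UNIV :: 'n set"] by auto
  then have e: "e i = e j \<longleftrightarrow> i = j" if "i < CARD('n)" "j < CARD('n)" for i j
    using that by (auto simp: bij_betw_def inj_on_def)
  have "paired_coordinates (\<lambda>k. e (2 * k)) (\<lambda>k. e (2 * k + 1)) (CARD('n) div 2) p"
  proof
    show "inj_on (\<lambda>k. e (2 * k)) {..<CARD('n) div 2}"
      by (rule inj_onI) (subst (asm) e, auto)
    show "inj_on (\<lambda>k. e (2 * k + 1)) {..<CARD('n) div 2}"
      by (rule inj_onI) (subst (asm) e, auto)
    show "e (2 * k) \<noteq> e (2 * l + 1)" if "k < CARD('n) div 2" "l < CARD('n) div 2" for k l
      using that by (subst e) (auto, presburger)
  qed (use assms in auto)
  then show ?thesis by blast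
qed

theorem theorem4p1:
  fixes p :: nat
  assumes "CARD('m::finite) \<ge> 2" and "CARD('n::finite) \<ge> 2"
    and "CARD('n) div 2 \<ge> p"
  shows "enat (CARD('n) div 2 + p + 1)
           \<le> min (max_pareto_components TYPE('m) TYPE('n) p)
                 (max_weak_pareto_components TYPE('m) TYPE('n) p)"
proof -
  obtain a b :: "nat \<Rightarrow> 'n" where "paired_coordinates a b (CARD('n) div 2) p"
    using exists_paired_coordinates assms(3) by blast
  then interpret paired_coordinates a b "CARD('n) div 2" p .
  obtain i0 i1 :: 'm where "i1 \<noteq> i0"
    using assms(1) card_le_Suc0_iff_eq[of "UNIV :: 'm set"] by auto
  note ge = num_components_ge[OF this]
  have "num_components (pareto_solutions K (F i0)) \<le> max_pareto_components TYPE('m) TYPE('n) p"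
    unfolding max_pareto_components_def by (rule Sup_upper) (use monotone_avvi_F in blast)
  moreover have "num_components (weak_pareto_solutions K (F i0))
      \<le> max_weak_pareto_components TYPE('m) TYPE('n) p"
    unfolding max_weak_pareto_components_def by (rule Sup_upper) (use monotone_avvi_F in blast)
  ultimately show ?thesis using ge by (meson min.boundedI order_trans)
qed

end
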